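(* Let $k\ge1$ be an integer, suppose $\mathrm{ITV}_i=[m_i,M_i]$ is a real interval for every $i\in\{1,\dots,k\}$, and let $f:\mathbb{R}^k\to\mathbb{R}$ be any monotone continuous function. Then every online algorithm $\mathrm{ALG}_k$ for the multi-objective time series search problem satisfies $\mathcal{CR}^f(\mathrm{ALG}_k)\ge z_f^k$.
   Context: Fix reals $0<m_i\le M_i$, $i=1,\dots,k$; the price set for objective $i$ is $\mathrm{ITV}_i=[m_i,M_i]$. An input is a finite sequence $I=(\vec p_1,\dots,\vec p_T)$, $T\ge1$, of price vectors $\vec p_t=(p_t^1,\dots,p_t^k)\in \mathrm{ITV}_1\times\cdots\times\mathrm{ITV}_k$. A (deterministic) online algorithm $\mathrm{ALG}_k$ knows all $m_i,M_i$; at time $t$ it sees $\vec p_t$ and must irrevocably accept or reject it, the decision depending only on $\vec p_1,\dots,\vec p_t$ (not on $T$ or later prices). If it accepts $\vec p_t$ the game ends and its return is $\mathrm{ALG}_k(I)=\vec p_t$; if it rejects every price vector its return is $(m_1,\dots,m_k)$. $\vec x\preceq\vec y$ means $x_i\le y_i$ for all $i$; $f$ is monotone if $\vec x\preceq\vec y$ implies $f(\vec x)\le f(\vec y)$. $\mathrm{OPT}_k[I]$ is the set of price vectors $\vec p_t$ of $I$ such that no price vector $\vec p_s\neq \vec p_t$ of $I$ satisfies $\vec p_t\preceq\vec p_s$. $\mathcal{CR}^f(\mathrm{ALG}_k;I)=\sup_{\vec x\in\mathrm{OPT}_k[I]} f(x_1/\mathrm{ALG}_k(I)_1,\dots,x_k/\mathrm{ALG}_k(I)_k)$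 and $\mathcal{CR}^f(\mathrm{ALG}_k)=\sup_I\mathcal{CR}^f(\mathrm{ALG}_k;I)$ over all inputs. $\mathcal{S}_f^k=\{(x_1,\dots,x_k)\in[m_1,M_1]\times\cdots\times[m_k,M_k]: f(M_1/x_1,\dots,M_k/x_k)=f(x_1/m_1,\dots,x_k/m_k)\}$ and $z_f^k=\sup_{(x_1,\dots,x_k)\in\mathcal{S}_f^k} f(M_1/x_1,\dots,M_k/x_k)$. *)

theory Defs
  imports "HOL-Analysis.Analysis"
begin

text \<open>
  Price vectors live in \<^typ>\<open>real^'k\<close>, whose library order \<open>\<le>\<close> is the componentwise one; hence
  \<open>{m..M}\<close> is the product of the intervals \<open>[m\<^sub>i, M\<^sub>i]\<close>.
\<close>

definition inputs :: "real^'k \<Rightarrow> real^'k \<Rightarrow> (real^'k) list set" where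
  "inputs m M = {I. I \<noteq> [] \<and> set I \<subseteq> {m..M}}"

text \<open>
  A deterministic online algorithm is a predicate on nonempty histories: \<open>A [p\<^sub>1, \<dots>, p\<^sub>t]\<close> holds
  iff \<open>p\<^sub>t\<close> is accepted, given that the earlier prices were rejected. The bounds
  \<open>m\<close> and \<open>M\<close> are fixed and known to it, so they are not arguments.
\<close>

type_synonym 'k online_alg = "(real^'k) list \<Rightarrow> bool"

definition alg_return :: "real^'k \<Rightarrow> 'k online_alg \<Rightarrow> (real^'k) list \<Rightarrow> real^'k" where
  "alg_return m A I =
     (if \<exists>t<length I. A (take (Suc t) I)
      then I ! (LEAST t. t < length I \<and> A (take (Suc t) I))
      else m)"

definition opt :: "(real^'k) list \<Rightarrow> (real^'k) set" where
  "opt I = {p \<in> set I. \<not> (\<exists>q\<in>set I. q \<noteq> p \<and> p \<le> q)}"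

definition ratio :: "real^'k \<Rightarrow> real^'k \<Rightarrow> real^'k" where
  "ratio x y = (\<chi> i. x $ i / y $ i)"

text \<open>
  Suprema are taken in the extended reals, so that they need no boundedness side condition.
  If \<open>0 < m\<^sub>i \<le> M\<^sub>i\<close> and \<open>f\<close> is monotone and continuous, they all range over nonempty sets of
  reals bounded by \<open>f (ratio M m)\<close> and agree with the real suprema.
\<close>

definition comp_ratio_on ::
    "(real^'k \<Rightarrow> real) \<Rightarrow> real^'k \<Rightarrow> 'k online_alg \<Rightarrow> (real^'k) list \<Rightarrow> ereal" where
  "comp_ratio_on f m A I = (SUP x\<in>opt I. ereal (f (ratio x (alg_return m A I))))"

definition comp_ratio ::
    "(real^'k \<Rightarrow> real) \<Rightarrow> real^'k \<Rightarrow> real^'k \<Rightarrow> 'k online_alg \<Rightarrow> ereal" where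
  "comp_ratio f m M A = (SUP I\<in>inputs m M. comp_ratio_on f m A I)"

definition S_set :: "(real^'k \<Rightarrow> real) \<Rightarrow> real^'k \<Rightarrow> real^'k \<Rightarrow> (real^'k) set" where
  "S_set f m M = {x \<in> {m..M}. f (ratio M x) = f (ratio x m)}"

definition z_val :: "(real^'k \<Rightarrow> real) \<Rightarrow> real^'k \<Rightarrow> real^'k \<Rightarrow> ereal" where
  "z_val f m M = (SUP x\<in>S_set f m M. ereal (f (ratio M x)))"

end

theory Submission imports Defs begin

text \<open>
  For \<open>x \<in> S_set f m M\<close> the adversary first offers \<open>x\<close>. If the algorithm accepts, the adversary
  continues with \<open>M\<close>, forcing the value \<open>f (ratio M x)\<close>; if it rejects, the input stops and the
  value is \<open>f (ratio x m)\<close>, which is the same number.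
\<close>

text \<open>The history \<open>[x]\<close> is the first one examined, so index 0 is the least
  accepting one whatever \<open>xs\<close> is; the adversary may thus choose \<open>xs\<close> after
  the acceptance.\<close>

lemma alg_return_accept_first:
  assumes "A [x]"
  shows "alg_return m A (x # xs) = x"
proof -
  have "(LEAST t. t < length (x # xs) \<and> A (take (Suc t) (x # xs))) = 0"
    using assms by (intro Least_eq_0) simp
  then show ?thesis
    using assms by (auto simp: alg_return_def)
qed

lemma alg_return_reject_singleton:
  assumes "\<not> A [x]"
  shows "alg_return m A [x] = m"
  using assms by (simp add: alg_return_def)

text \<open>By antisymmetry no other entry can dominate a greatest one. Both adversarial inputs end
  in their greatest vector.\<close>

lemma mem_opt_if_upper_bound:
  assumes "p \<in> set I" and "\<And>q. q \<in> set I \<Longrightarrow> q \<le> p"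
  shows "p \<in> opt I"
  using assms by (auto simp: opt_def intro: order.antisym)

lemma comp_ratio_ge:
  assumes "I \<in> inputs m M" and "x \<in> opt I"
  shows "ereal (f (ratio x (alg_return m A I))) \<le> comp_ratio f m M A"
  unfolding comp_ratio_def comp_ratio_on_def
  using assms by (blast intro: SUP_upper2)

theorem theorem3:
  fixes m M :: "real^'k" and f :: "real^'k \<Rightarrow> real" and A :: "'k online_alg"
  assumes "\<And>i. 0 < m $ i" and "\<And>i. m $ i \<le> M $ i"
    and "mono f" and "continuous_on UNIV f"
  shows "comp_ratio f m M A \<ge> z_val f m M"
  unfolding z_val_def
proof (rule SUP_least)
  fix x assume "x \<in> S_set f m M"
  then have x: "m \<le> x" "x \<le> M" and eq: "f (ratio M x) = f (ratio x m)"
    by (auto simp: S_set_def)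
  show "ereal (f (ratio M x)) \<le> comp_ratio f m M A"
  proof (cases "A [x]")
    case True
    \<comment> \<open>\<open>M\<close> is an admissible price since
      \<open>m \<le> x \<le> M\<close>, and it is greatest in \<open>[x, M]\<close> even if
      \<open>x = M\<close>.\<close>
    have "[x, M] \<in> inputs m M" "M \<in> opt [x, M]"
      using x by (auto simp: inputs_def intro: mem_opt_if_upper_bound order.trans)
    from comp_ratio_ge[OF this, of f A] show ?thesis
      by (simp add: alg_return_accept_first[of A, OF True])
  next
    case False
    have "[x] \<in> inputs m M" "x \<in> opt [x]"
      using x by (auto simp: inputs_def intro: mem_opt_if_upper_bound)
    from comp_ratio_ge[OF this, of f A] show ?thesis
      by (simp add: alg_return_reject_singleton[of A, OF False] eq)
  qed
qed

end
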